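(* Let $F=\mathbb{F}_q$ be a finite field, let $m\ge 1$ be an integer and $R=F[x]/\langle x^m-1\rangle$. 1) Let $C\subseteq R^2$ be a quasi-cyclic code of length $2m$ and index $2$ over $F$. Then $C$ is generated by two elements $g_1=(g_{11}(x),g_{12}(x))$ and $g_2=(0,g_{22}(x))$, with $g_{11},g_{12},g_{22}\in F[x]$, satisfying the following conditions $(\ast)$: (i) $g_{11}(x)\mid (x^m-1)$ and $g_{22}(x)\mid (x^m-1)$; (ii) $\deg g_{12}(x)<\deg g_{22}(x)$; (iii) $g_{11}(x)g_{22}(x)\mid (x^m-1)g_{12}(x)$. Moreover, in this case (i.e. for generators satisfying $(\ast)$) $\dim_F C=2m-\deg g_{11}(x)-\deg g_{22}(x)$. 2) Let the code $C$ be generated by $g_1=(g_{11}(x),g_{12}(x))$ and $g_2=(0,g_{22}(x))$, and let the code $C'$ be generated by $g_1'=(g_{11}'(x),g_{12}'(x))$ and $g_2'=(0,g_{22}'(x))$, where both pairs of generators satisfy conditions $(\ast)$, and where $g_{11},g_{22},g_{11}',g_{22}'$ are monic. Then $C=C'$ if and only if $g_{11}(x)=g_{11}'(x)$, $g_{22}(x)=g_{22}'(x)$ and $g_{12}(x)=g_{12}'(x)$.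
   Context: A quasi-cyclic code of length $2m$ and index $2$ over $F$ is a linear subspace of $F^{2m}$ invariant under $T^2$, where $T$ is the cyclic shift. Via $(c_{0,0},c_{0,1},c_{1,0},c_{1,1},\dots,c_{m-1,0},c_{m-1,1})\mapsto (c_0(x),c_1(x))$, $c_j(x)=\sum_{i=0}^{m-1}c_{i,j}x^i$, such codes are identified with $R$-submodules of $R^2$. "Generated by" means generated as an $R$-module; polynomials in $F[x]$ are also regarded as elements of $R$ by reduction modulo $x^m-1$. Divisibility in $(\ast)$ is in $F[x]$; the convention $\deg 0=-\infty$ is used, so $g_{12}=0$ is allowed. *)

theory Defs
  imports
    "HOL-Algebra.QuotRing"
    "HOL-Library.Extended_Real"
    "Jordan_Normal_Form.VS_Connect"
begin

text \<open>The ring \<open>R = F[x] / (x^m - 1)\<close>; its elements are cosets, i.e. sets of polynomials.\<close>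

definition xm1 :: "nat \<Rightarrow> 'a :: field poly" where
  "xm1 m = monom 1 m - 1"

definition qc_ideal :: "nat \<Rightarrow> 'a :: field poly set" where
  "qc_ideal m = PIdl\<^bsub>class_ring\<^esub> (xm1 m)"

definition qc_ring :: "nat \<Rightarrow> 'a :: field poly set ring" where
  "qc_ring m = class_ring Quot (qc_ideal m)"

definition qc_class :: "nat \<Rightarrow> 'a :: field poly \<Rightarrow> 'a poly set" where
  "qc_class m p = qc_ideal m +>\<^bsub>class_ring\<^esub> p"

text \<open>A commutative ring as a module over itself.\<close>

definition regular_module :: "'b ring \<Rightarrow> ('b, 'b) module" where
  "regular_module R =
    \<lparr>carrier = carrier R, mult = mult R, one = one R, zero = zero R, add = add R, smult = mult R\<rparr>"

definition qc_module :: "nat \<Rightarrow> ('a :: field poly set, 'a poly set \<times> 'a poly set) module" where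
  "qc_module m = direct_sum (regular_module (qc_ring m)) (regular_module (qc_ring m))"

text \<open>The cyclic shift \<open>(v\<^sub>0, \<dots>, v\<^sub>n\<^sub>-\<^sub>1) \<mapsto> (v\<^sub>n\<^sub>-\<^sub>1, v\<^sub>0, \<dots>, v\<^sub>n\<^sub>-\<^sub>2)\<close>.\<close>

definition cyclic_shift :: "'a vec \<Rightarrow> 'a vec" where
  "cyclic_shift v = vec (dim_vec v) (\<lambda>i. v $ ((i + dim_vec v - 1) mod dim_vec v))"

definition quasi_cyclic_code :: "nat \<Rightarrow> nat \<Rightarrow> 'a :: field vec set \<Rightarrow> bool" where
  "quasi_cyclic_code n l C \<longleftrightarrow>
    VectorSpace.subspace class_ring C (module_vec TYPE('a) n) \<and>
    (\<forall>c\<in>C. (cyclic_shift ^^ l) c \<in> C)"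

definition code_dim :: "nat \<Rightarrow> 'a :: field vec set \<Rightarrow> nat" where
  "code_dim n C = vectorspace.dim class_ring (module_vec TYPE('a) n \<lparr>carrier := C\<rparr>)"

text \<open>The entry \<open>c\<^sub>i\<^sub>,\<^sub>j\<close> of a codeword (\<open>i < m\<close>, \<open>j < 2\<close>) sits at position \<open>2 * i + j\<close>.\<close>

definition component_poly :: "nat \<Rightarrow> 'a :: field vec \<Rightarrow> nat \<Rightarrow> 'a poly" where
  "component_poly m c j = (\<Sum>i<m. monom (c $ (2 * i + j)) i)"

definition qc_embed :: "nat \<Rightarrow> 'a :: field vec \<Rightarrow> 'a poly set \<times> 'a poly set" where
  "qc_embed m c = (qc_class m (component_poly m c 0), qc_class m (component_poly m c 1))"

text \<open>The code \<open>C\<close>, viewed in \<open>R\<^sup>2\<close>, is the \<open>R\<close>-submodule generated by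
  \<open>(g11, g12)\<close> and \<open>(0, g22)\<close>.\<close>

definition generated_by ::
  "nat \<Rightarrow> 'a :: field vec set \<Rightarrow> 'a poly \<Rightarrow> 'a poly \<Rightarrow> 'a poly \<Rightarrow> bool" where
  "generated_by m C g11 g12 g22 \<longleftrightarrow>
    qc_embed m ` C =
      LinearCombinations.module.span (qc_ring m) (qc_module m)
        {(qc_class m g11, qc_class m g12), (qc_class m 0, qc_class m g22)}"

text \<open>The degree with the convention that the zero polynomial has degree \<open>-\<infinity>\<close>.\<close>

definition ext_degree :: "'a :: zero poly \<Rightarrow> ereal" where
  "ext_degree p = (if p = 0 then - \<infinity> else ereal (real (degree p)))"

definition star_conditions ::
  "nat \<Rightarrow> 'a :: field poly \<Rightarrow> 'a poly \<Rightarrow> 'a poly \<Rightarrow> bool" where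
  "star_conditions m g11 g12 g22 \<longleftrightarrow>
    g11 dvd xm1 m \<and> g22 dvd xm1 m \<and>
    ext_degree g12 < ext_degree g22 \<and>
    g11 * g22 dvd xm1 m * g12"

end

(* A quasi-cyclic code C lifts to the F[x]-submodule of F[x]^2 of all pairs whose residues modulo
   x^m - 1 lie in C. This lift contains (x^m - 1) F[x]^2, so eliminating with principal ideals of F[x]
   (first the ideal of first coordinates, then that of second coordinates of pairs (0, b)) puts it in
   Hermite normal form, which is (\<ast>). Conversely, (iii) says that (x^m - 1, 0) is a combination
   of g1 and g2, so generators satisfying (\<ast>) form an F[x]-basis of the lift itself. Comparing bases of
   the lift gives uniqueness, and (u, v) with deg u < m - deg g11 and deg v < m - deg g22 parametrises
   C linearly and bijectively by u g1 + v g2, which gives the dimension. *)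

theory Submission
  imports Defs
begin

section \<open>The polynomial \<open>x^m - 1\<close> and the quotient ring \<open>R\<close>\<close>

lemma coeff_xm1: "coeff (xm1 m :: 'a :: field poly) i = (if i = m then 1 else 0) - (if i = 0 then 1 else 0)"
  by (auto simp: xm1_def)

lemma degree_xm1 [simp]:
  assumes "m \<ge> 1"
  shows "degree (xm1 m :: 'a :: field poly) = m"
proof (rule antisym)
  show "degree (xm1 m :: 'a poly) \<le> m"
    by (rule degree_le) (auto simp: coeff_xm1)
  show "m \<le> degree (xm1 m :: 'a poly)"
    using assms by (intro le_degree) (auto simp: coeff_xm1)
qed

lemma xm1_nonzero [simp]:
  assumes "m \<ge> 1"
  shows "(xm1 m :: 'a :: field poly) \<noteq> 0"
proof
  assume "(xm1 m :: 'a poly) = 0"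
  then have "degree (xm1 m :: 'a poly) = 0" by simp
  with assms show False by simp
qed

lemma qc_ideal_eq: "qc_ideal m = {p. xm1 m dvd p}"
  by (auto simp: qc_ideal_def cgenideal_def dvd_def mult.commute)

lemma class_ring_poly_cring: "cring (class_ring :: 'a :: field poly ring)"
  by unfold_locales

lemma qc_ideal_ideal: "ideal (qc_ideal m :: 'a :: field poly set) class_ring"
  unfolding qc_ideal_def by (rule cring.cgenideal_ideal[OF class_ring_poly_cring]) simp

lemma qc_ring_hom:
  "ring_hom_cring class_ring (qc_ring m) (qc_class m :: 'a :: field poly \<Rightarrow> _)"
proof -
  interpret ideal "qc_ideal m :: 'a poly set" class_ring by (rule qc_ideal_ideal)
  have "qc_class m = (\<lambda>p :: 'a poly. qc_ideal m +>\<^bsub>class_ring\<^esub> p)"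
    by (rule ext) (simp add: qc_class_def)
  then show ?thesis
    using rcos_ring_hom_cring[OF class_ring_poly_cring] unfolding qc_ring_def by simp
qed

lemma carrier_qc_ring: "carrier (qc_ring m) = range (qc_class m :: 'a :: field poly \<Rightarrow> _)"
  by (auto simp: qc_ring_def FactRing_def A_RCOSETS_def' qc_class_def a_r_coset_def' )

text \<open>The coset of \<open>r\<close> is the set of all \<open>s\<close> with
  \<open>xm1 m dvd s - r\<close>. This lets later arguments about classes run as divisibility in
  \<open>F[x]\<close>.\<close>

lemma qc_class_eq_iff: "qc_class m p = qc_class m q \<longleftrightarrow> xm1 m dvd p - q"
proof -
  have coset: "qc_class m r = {s. xm1 m dvd s - r}" for r :: "'a poly"
    by (force simp: qc_class_def a_r_coset_def' qc_ideal_eq)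
  show ?thesis
  proof
    assume "qc_class m p = qc_class m q"
    moreover have "p \<in> qc_class m p" by (simp add: coset)
    ultimately show "xm1 m dvd p - q" by (simp add: coset)
  next
    assume pq: "xm1 m dvd p - q"
    have "xm1 m dvd s - p \<longleftrightarrow> xm1 m dvd s - q" for s
      using dvd_diff_left_iff[OF pq, of "s - q"] by simp
    then show "qc_class m p = qc_class m q" by (simp add: coset)
  qed
qed

lemma qc_ring_ops:
  fixes p q :: "'a :: field poly"
  shows "qc_class m p \<oplus>\<^bsub>qc_ring m\<^esub> qc_class m q = qc_class m (p + q)"
    and "qc_class m p \<otimes>\<^bsub>qc_ring m\<^esub> qc_class m q = qc_class m (p * q)"
    and "\<zero>\<^bsub>qc_ring m\<^esub> = qc_class m (0 :: 'a poly)"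
proof -
  interpret ring_hom_cring class_ring "qc_ring m" "qc_class m :: 'a poly \<Rightarrow> _" by (rule qc_ring_hom)
  show "qc_class m p \<oplus>\<^bsub>qc_ring m\<^esub> qc_class m q = qc_class m (p + q)"
    using hom_add[of p q] by simp
  show "qc_class m p \<otimes>\<^bsub>qc_ring m\<^esub> qc_class m q = qc_class m (p * q)"
    using hom_mult[of p q] by simp
  show "\<zero>\<^bsub>qc_ring m\<^esub> = qc_class m (0 :: 'a poly)"
    using hom_zero by simp
qed

section \<open>The module \<open>R^2\<close> and the span of two generators\<close>

lemma regular_module_module:
  assumes "cring R"
  shows "module R (regular_module R)"
proof -
  interpret cring R by fact
  show ?thesis
    by (rule moduleI)
       (auto simp: regular_module_def is_cring l_distr r_distr m_assoc a_ac
             intro!: abelian_groupI intro: l_neg)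
qed

lemma qc_module_module: "module (qc_ring m) (qc_module m :: ('a :: field poly set, _) module)"
proof -
  interpret ring_hom_cring class_ring "qc_ring m" "qc_class m :: 'a poly \<Rightarrow> _" by (rule qc_ring_hom)
  show ?thesis unfolding qc_module_def
    by (intro direct_sum_is_module regular_module_module) (rule S.is_cring)+
qed

lemma qc_module_simps:
  fixes a b c d :: "'a :: field poly"
  shows "carrier (qc_module m) = range (qc_class m :: 'a poly \<Rightarrow> _) \<times> range (qc_class m :: 'a poly \<Rightarrow> _)"
    and "(qc_class m a, qc_class m b) \<oplus>\<^bsub>qc_module m\<^esub> (qc_class m c, qc_class m d)
      = (qc_class m (a + c), qc_class m (b + d))"
    and "qc_class m a \<odot>\<^bsub>qc_module m\<^esub> (qc_class m b, qc_class m c)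
      = (qc_class m (a * b), qc_class m (a * c))"
    and "\<zero>\<^bsub>qc_module m\<^esub> = (qc_class m (0 :: 'a poly), qc_class m 0)"
  by (simp_all add: qc_module_def direct_sum_def regular_module_def qc_ring_ops carrier_qc_ring)

text \<open>The explicit set of combinations is a submodule containing both generators, so it
  contains the span; closure of the span gives the converse. The coefficients are polynomials rather
  than classes, which prepares the passage to \<open>F[x]^2\<close>.\<close>

lemma span_two_generators:
  fixes g11 g12 g22 :: "'a :: field poly"
  shows "LinearCombinations.module.span (qc_ring m) (qc_module m)
      {(qc_class m g11, qc_class m g12), (qc_class m 0, qc_class m g22)}
    = {(qc_class m (u * g11), qc_class m (u * g12 + v * g22)) | u v. True}" (is "_ = ?N")
proof -
  interpret module "qc_ring m" "qc_module m :: ('a poly set, _) module" by (rule qc_module_module)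
  let ?S = "{(qc_class m g11, qc_class m g12), (qc_class m 0, qc_class m g22)}"
  have S: "?S \<subseteq> carrier (qc_module m)" by (simp add: qc_module_simps)
  have "submodule (qc_ring m) ?N (qc_module m)"
  proof (unfold_locales, goal_cases)
    case 1
    then show ?case by (auto simp: qc_module_simps)
  next
    case (2 x y)
    then obtain u v u' v' where
      "x = (qc_class m (u * g11), qc_class m (u * g12 + v * g22))"
      "y = (qc_class m (u' * g11), qc_class m (u' * g12 + v' * g22))" by blast
    then show ?case
      by (intro CollectI exI[of _ "u + u'"] exI[of _ "v + v'"]) (simp add: qc_module_simps algebra_simps)
  next
    case 3
    then show ?case by (intro CollectI exI[of _ 0]) (simp add: qc_module_simps)
  next
    case (4 c x)
    then obtain u v w where
      "x = (qc_class m (u * g11), qc_class m (u * g12 + v * g22))" "c = qc_class m w"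
      by (auto simp: carrier_qc_ring)
    then show ?case
      by (intro CollectI exI[of _ "w * u"] exI[of _ "w * v"]) (simp add: qc_module_simps algebra_simps)
  qed
  moreover have "?S \<subseteq> ?N"
  proof -
    have "(qc_class m (1 * g11), qc_class m (1 * g12 + 0 * g22)) \<in> ?N"
      and "(qc_class m (0 * g11), qc_class m (0 * g12 + 1 * g22)) \<in> ?N" by blast+
    then show ?thesis by simp
  qed
  ultimately have "span ?S \<subseteq> ?N" by (intro span_is_subset)
  moreover have "?N \<subseteq> span ?S"
  proof clarify
    fix u v
    interpret sp: submodule "qc_ring m" "span ?S" "qc_module m" by (rule span_is_submodule[OF S])
    have "qc_class m u \<odot>\<^bsub>qc_module m\<^esub> (qc_class m g11, qc_class m g12)
        \<oplus>\<^bsub>qc_module m\<^esub> qc_class m v \<odot>\<^bsub>qc_module m\<^esub> (qc_class m 0, qc_class m g22) \<in> span ?S"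
      using in_own_span[OF S] by (intro sp.m_closed sp.smult_closed) (auto simp: carrier_qc_ring)
    then show "(qc_class m (u * g11), qc_class m (u * g12 + v * g22)) \<in> span ?S"
      by (simp add: qc_module_simps)
  qed
  ultimately show ?thesis by blast
qed

section \<open>Codewords as pairs of residues modulo \<open>x^m - 1\<close>\<close>

text \<open>Goes back from pairs of polynomials to vectors. Reduction modulo \<open>xm1 m\<close>
  makes it total on \<open>F[x]^2\<close>, so the lift of a code \<open>C\<close> is simply the
  preimage of \<open>C\<close> under \<open>codeword m\<close>.\<close>

definition codeword :: "nat \<Rightarrow> 'a :: field poly \<Rightarrow> 'a poly \<Rightarrow> 'a vec" where
  "codeword m a b = vec (2 * m) (\<lambda>k. coeff ((if even k then a else b) mod xm1 m) (k div 2))"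

lemma codeword_carrier [simp]: "codeword m a b \<in> carrier_vec (2 * m)"
  by (simp add: codeword_def)

lemma codeword_add: "codeword m (a + c) (b + d) = codeword m a b + codeword m c d"
  by (rule eq_vecI) (simp_all add: codeword_def poly_mod_add_left)

lemma codeword_smult:
  "codeword m (Polynomial.smult c a) (Polynomial.smult c b) = c \<cdot>\<^sub>v codeword m a b"
  by (rule eq_vecI) (simp_all add: codeword_def mod_smult_left)

lemma codeword_0 [simp]: "codeword m 0 0 = 0\<^sub>v (2 * m)"
  by (rule eq_vecI) (simp_all add: codeword_def)

lemma degree_mod_xm1:
  assumes "m \<ge> 1"
  shows "degree (a mod xm1 m :: 'a :: field poly) < m"
  using degree_mod_less[of "xm1 m" a] assms by auto

lemma coeff_component_poly: "coeff (component_poly m c j) i = (if i < m then c $ (2 * i + j) else 0)"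
  by (auto simp: component_poly_def coeff_sum if_distrib cong: if_cong)

lemma component_poly_codeword:
  assumes "m \<ge> 1" "j < 2"
  shows "component_poly m (codeword m a b) j = (if j = 0 then a else b) mod xm1 m"
proof (rule poly_eqI)
  fix i
  show "coeff (component_poly m (codeword m a b) j) i = coeff ((if j = 0 then a else b) mod xm1 m) i"
  proof (cases "i < m")
    case True
    with assms(2) show ?thesis
      by (cases "j = 0") (simp_all add: coeff_component_poly codeword_def less_2_cases_iff)
  next
    case False
    have "degree ((if j = 0 then a else b) mod xm1 m) < m" by (rule degree_mod_xm1[OF assms(1)])
    with False show ?thesis by (simp add: coeff_component_poly coeff_eq_0)
  qed
qed

text \<open>The vector determines both residues, since \<open>component_poly\<close> reads them
  back. With additivity, this says that the kernel of \<open>codeword m\<close> is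
  \<open>(x^m - 1) F[x]^2\<close>.\<close>

lemma codeword_eq_iff:
  assumes "m \<ge> 1"
  shows "codeword m a b = codeword m c d \<longleftrightarrow> xm1 m dvd a - c \<and> xm1 m dvd b - d"
  unfolding mod_eq_dvd_iff[symmetric]
proof
  assume eq: "codeword m a b = codeword m c d"
  have "component_poly m (codeword m a b) j = component_poly m (codeword m c d) j" for j
    by (simp add: eq)
  from this[of 0] this[of 1] show "a mod xm1 m = c mod xm1 m \<and> b mod xm1 m = d mod xm1 m"
    by (simp add: component_poly_codeword[OF assms])
qed (simp add: codeword_def if_distrib[of "\<lambda>p. p mod xm1 m"] cong: if_cong)

lemma codeword_component_poly:
  assumes "m \<ge> 1" "c \<in> carrier_vec (2 * m)"
  shows "codeword m (component_poly m c 0) (component_poly m c 1) = c"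
proof -
  have "degree (component_poly m c j) < m" for j
    using assms(1) by (intro degree_lessI) (auto simp: coeff_component_poly)
  then have "component_poly m c j mod xm1 m = component_poly m c j" for j
    using assms(1) by (intro mod_poly_less) simp
  with assms(2) show ?thesis
    by (intro eq_vecI) (auto simp: codeword_def coeff_component_poly elim!: evenE oddE)
qed

lemma qc_embed_codeword:
  assumes "m \<ge> 1"
  shows "qc_embed m (codeword m a b) = (qc_class m a, qc_class m b)"
  using assms by (auto simp: qc_embed_def component_poly_codeword qc_class_eq_iff mod_eq_dvd_iff[symmetric])

lemma inj_on_qc_embed:
  assumes "m \<ge> 1"
  shows "inj_on (qc_embed m) (carrier_vec (2 * m) :: 'a :: field vec set)"
proof (rule inj_onI)
  fix c d :: "'a vec"
  assume cd: "c \<in> carrier_vec (2 * m)" "d \<in> carrier_vec (2 * m)" and eq: "qc_embed m c = qc_embed m d"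
  have "codeword m (component_poly m c 0) (component_poly m c 1)
      = codeword m (component_poly m d 0) (component_poly m d 1)"
    using eq by (simp add: codeword_eq_iff[OF assms] qc_embed_def qc_class_eq_iff)
  then show "c = d" using cd by (metis codeword_component_poly[OF assms])
qed

section \<open>The squared cyclic shift as multiplication by \<open>x\<close>\<close>

lemma cyclic_shift_twice:
  assumes "m \<ge> 1" "v \<in> carrier_vec (2 * m)"
  shows "(cyclic_shift ^^ 2) v = vec (2 * m) (\<lambda>k. v $ ((k + 2 * m - 2) mod (2 * m)))"
proof (rule eq_vecI)
  fix k assume "k < dim_vec (vec (2 * m) (\<lambda>k. v $ ((k + 2 * m - 2) mod (2 * m))))"
  then have k: "k < 2 * m" by simp
  have "((k + 2 * m - 1) mod (2 * m) + 2 * m - 1) mod (2 * m)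
      = ((k + 2 * m - 1) mod (2 * m) + (2 * m - 1)) mod (2 * m)"
    using assms(1) by simp
  also have "\<dots> = (k + 2 * m - 1 + (2 * m - 1)) mod (2 * m)"
    by (rule mod_add_left_eq)
  also have "k + 2 * m - 1 + (2 * m - 1) = k + 2 * m - 2 + 2 * m"
    using assms(1) by simp
  also have "\<dots> mod (2 * m) = (k + 2 * m - 2) mod (2 * m)" by simp
  finally show "(cyclic_shift ^^ 2) v $ k = vec (2 * m) (\<lambda>k. v $ ((k + 2 * m - 2) mod (2 * m))) $ k"
    using k assms by (simp add: cyclic_shift_def numeral_2_eq_2)
qed (use assms in \<open>simp add: cyclic_shift_def numeral_2_eq_2\<close>)

text \<open>Multiplying the residue of \<open>a\<close> by \<open>x\<close> raises its degree to at
  most \<open>m\<close>; subtracting the right scalar multiple of the monic \<open>xm1 m\<close>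
  removes the coefficient at \<open>m\<close>.\<close>

lemma pCons_mod_xm1:
  assumes "m \<ge> 1"
  shows "pCons 0 a mod xm1 m =
    pCons 0 (a mod xm1 m) - Polynomial.smult (coeff (a mod xm1 m) (m - 1)) (xm1 m :: 'a :: field poly)"
    (is "_ = ?r")
proof -
  let ?p = "a mod xm1 m"
  have high: "coeff ?p i = 0" if "i \<ge> m" for i
    using degree_mod_xm1[OF assms, of a] that by (intro coeff_eq_0) simp
  have "degree ?r < m"
  proof (rule degree_lessI)
    show "?r \<noteq> 0 \<or> m > 0" using assms by simp
    \<comment> \<open>At \<open>k = m\<close> the two terms cancel; above \<open>m\<close> both
      vanish.\<close>
    show "\<forall>k\<ge>m. coeff ?r k = 0"
      using assms high by (auto simp: coeff_pCons coeff_xm1 split: nat.splits)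
  qed
  then have "?r mod xm1 m = ?r" using assms by (intro mod_poly_less) simp
  moreover have "xm1 m dvd pCons 0 a - ?r"
  proof -
    have "xm1 m dvd pCons 0 (a - ?p)"
      using dvd_mult[of "xm1 m" "a - ?p" "[:0, 1:]"] by (simp add: mod_eq_dvd_iff[symmetric])
    moreover have "pCons 0 a - ?r = pCons 0 (a - ?p) + Polynomial.smult (coeff ?p (m - 1)) (xm1 m)"
      by simp
    ultimately show ?thesis by (simp only: dvd_add dvd_smult dvd_refl)
  qed
  ultimately show ?thesis by (simp add: mod_eq_dvd_iff[symmetric])
qed

lemma codeword_pCons:
  fixes a b :: "'a :: field poly"
  assumes "m \<ge> 1"
  shows "codeword m (pCons 0 a) (pCons 0 b) = (cyclic_shift ^^ 2) (codeword m a b)"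
proof (subst cyclic_shift_twice[OF assms codeword_carrier], rule eq_vecI)
  fix k
  assume "k < dim_vec (vec (2 * m) (\<lambda>k. codeword m a b $ ((k + 2 * m - 2) mod (2 * m))))"
  then have k: "k < 2 * m" by simp
  let ?p = "if even k then a else b"
  have if_pCons: "(if even k then pCons 0 a else pCons 0 b) = pCons 0 ?p" by simp
  have lhs: "codeword m (pCons 0 a) (pCons 0 b) $ k = coeff (pCons 0 ?p mod xm1 m) (k div 2)"
    using k by (simp only: codeword_def index_vec if_pCons)
  show "codeword m (pCons 0 a) (pCons 0 b) $ k
      = vec (2 * m) (\<lambda>k. codeword m a b $ ((k + 2 * m - 2) mod (2 * m))) $ k"
  proof (cases "k < 2")
    \<comment> \<open>Wrap-around: the shift brings in coefficient \<open>m - 1\<close> of the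
      component of the same parity. On the polynomial side it comes from the constant term
      \<open>-1\<close> of \<open>xm1 m\<close>.\<close>
    case True
    then have l: "(k + 2 * m - 2) mod (2 * m) = 2 * (m - 1) + k"
      using assms by (subst mod_less) auto
    have "k div 2 = 0" "(2 * (m - 1) + k) div 2 = m - 1" using True by auto
    then show ?thesis
      using k assms True by (simp add: lhs pCons_mod_xm1 coeff_xm1 l) (simp add: codeword_def)
  next
    \<comment> \<open>Here \<open>Suc (l div 2)\<close> lies strictly between 0 and
      \<open>m\<close>, where \<open>xm1 m\<close> has coefficient 0, so only the shifted residue
      contributes.\<close>
    case False
    then obtain l where l: "k = l + 2" by (metis add.commute le_Suc_ex not_less)
    then have "(k + 2 * m - 2) mod (2 * m) = l" using k by simp
    moreover have "k div 2 = Suc (l div 2)" "even k = even l" "Suc (l div 2) < m" using l k by auto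
    ultimately show ?thesis
      using k by (simp add: lhs pCons_mod_xm1[OF assms] coeff_xm1) (use l k in \<open>simp add: codeword_def\<close>)
  qed
qed (simp add: codeword_def)

section \<open>Quasi-cyclic codes as \<open>F[x]\<close>-modules\<close>

lemma quasi_cyclic_codeD:
  fixes C :: "'a :: field vec set"
  assumes "quasi_cyclic_code n l C"
  shows "C \<subseteq> carrier_vec n" and "0\<^sub>v n \<in> C"
    and "\<And>c d. c \<in> C \<Longrightarrow> d \<in> C \<Longrightarrow> c + d \<in> C"
    and "\<And>k c. c \<in> C \<Longrightarrow> k \<cdot>\<^sub>v c \<in> C"
    and "\<And>c. c \<in> C \<Longrightarrow> (cyclic_shift ^^ l) c \<in> C"
proof -
  have "submodule class_ring C (module_vec TYPE('a) n)"
    using assms by (simp add: quasi_cyclic_code_def VectorSpace.subspace_def)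
  then interpret submodule class_ring C "module_vec TYPE('a) n" .
  show "C \<subseteq> carrier_vec n" using subset by (simp add: module_vec_simps)
  show "0\<^sub>v n \<in> C" using zero_closed by (simp add: module_vec_simps)
  show "c + d \<in> C" if "c \<in> C" "d \<in> C" for c d
    using m_closed[OF that] by (simp add: module_vec_simps)
  show "k \<cdot>\<^sub>v c \<in> C" if "c \<in> C" for k c
    using smult_closed[OF _ that, of k] by (simp add: module_vec_simps)
  show "(cyclic_shift ^^ l) c \<in> C" if "c \<in> C" for c
    using that assms by (simp add: quasi_cyclic_code_def)
qed

text \<open>Horner induction on \<open>p\<close>: scalars act by linearity of \<open>C\<close>, and
  multiplication by \<open>x\<close> is the squared shift.\<close>

lemma codeword_mult_closed:
  fixes C :: "'a :: field vec set"
  assumes "m \<ge> 1" and C: "quasi_cyclic_code (2 * m) 2 C" and "codeword m a b \<in> C"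
  shows "codeword m (p * a) (p * b) \<in> C"
proof (induction p)
  case 0
  then show ?case using quasi_cyclic_codeD(2)[OF C] by simp
next
  case (pCons k p)
  have "codeword m (pCons k p * a) (pCons k p * b)
      = k \<cdot>\<^sub>v codeword m a b + (cyclic_shift ^^ 2) (codeword m (p * a) (p * b))"
    by (simp add: codeword_add codeword_smult codeword_pCons[OF assms(1)])
  then show ?case
    using quasi_cyclic_codeD[OF C] assms(3) pCons.IH by simp
qed

section \<open>Reduction to \<open>F[x]^2\<close> and existence of generators\<close>

text \<open>A nonzero element of least degree generates, since the remainder of any element on
  division by it stays in \<open>I\<close>. Plain closure assumptions make this directly applicable
  to the two coordinate ideals of the lift.\<close>

lemma poly_ideal_principal:
  fixes I :: "'a :: field poly set"
  assumes "p \<in> I" "p \<noteq> 0"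
    and add: "\<And>a b. a \<in> I \<Longrightarrow> b \<in> I \<Longrightarrow> a + b \<in> I"
    and mult: "\<And>a q. a \<in> I \<Longrightarrow> q * a \<in> I"
  obtains g where "g \<in> I" "g \<noteq> 0" "\<And>a. a \<in> I \<Longrightarrow> g dvd a"
proof -
  obtain g where g: "g \<in> I" "g \<noteq> 0" and min: "\<And>a. a \<in> I \<Longrightarrow> a \<noteq> 0 \<Longrightarrow> degree g \<le> degree a"
    using ex_has_least_nat[of "\<lambda>a. a \<in> I \<and> a \<noteq> 0" p degree] assms(1,2) by blast
  have "g dvd a" if "a \<in> I" for a
  proof (rule ccontr)
    assume "\<not> g dvd a"
    then have "a mod g \<noteq> 0" by (simp add: dvd_eq_mod_eq_0)
    moreover have "a mod g = a + (- (a div g)) * g"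
      by (simp add: minus_div_mult_eq_mod[symmetric])
    then have "a mod g \<in> I" using add[OF that mult[OF g(1)]] by metis
    ultimately show False
      using min[of "a mod g"] degree_mod_less[OF g(2), of a] by simp
  qed
  with g that show ?thesis by blast
qed

text \<open>Cancelling \<open>g11\<close> in condition (iii) leaves \<open>g22 dvd h1 * g12\<close>,
  with quotient \<open>s\<close>. In terms of the generators, \<open>(xm1 m, 0)\<close> is
  \<open>h1 g1 - s g2\<close> and \<open>(0, xm1 m)\<close> is \<open>h2 g2\<close>.\<close>

lemma star_conditionsE:
  assumes "m \<ge> 1" "star_conditions m g11 g12 g22"
  obtains h1 h2 s where "xm1 m = g11 * h1" "xm1 m = g22 * h2" "h1 * g12 = s * g22"
    "g11 \<noteq> 0" "g22 \<noteq> 0" "h1 \<noteq> 0" "h2 \<noteq> 0" "g12 = 0 \<or> degree g12 < degree g22"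
proof -
  obtain h1 h2 where h: "xm1 m = g11 * h1" "xm1 m = g22 * h2"
    using assms(2) by (auto simp: star_conditions_def elim!: dvdE)
  have nz: "g11 \<noteq> 0" "g22 \<noteq> 0" "h1 \<noteq> 0" "h2 \<noteq> 0"
    using xm1_nonzero[OF assms(1)] h by (metis mult_zero_left mult_zero_right)+
  have "g11 * g22 dvd g11 * (h1 * g12)"
    using assms(2) h(1) by (simp add: star_conditions_def mult.assoc)
  then have "g22 dvd h1 * g12" using nz(1) by simp
  then obtain s where "h1 * g12 = s * g22" by (metis dvdE mult.commute)
  moreover have "g12 = 0 \<or> degree g12 < degree g22"
    using assms(2) nz(2) by (auto simp: star_conditions_def ext_degree_def split: if_splits)
  ultimately show ?thesis using that h nz by blast
qed

text \<open>Moves the equality of subsets of \<open>R^2\<close> to representatives in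
  \<open>F[x]^2\<close>; injectivity of \<open>qc_embed m\<close> turns membership in the image back
  into membership in \<open>C\<close>.\<close>

lemma generated_by_iff:
  assumes "m \<ge> 1" "C \<subseteq> carrier_vec (2 * m)"
  shows "generated_by m C g11 g12 g22 \<longleftrightarrow>
    (\<forall>a b. codeword m a b \<in> C \<longleftrightarrow>
      (\<exists>u v. xm1 m dvd a - u * g11 \<and> xm1 m dvd b - (u * g12 + v * g22)))"
proof -
  define N where "N = {(qc_class m (u * g11), qc_class m (u * g12 + v * g22)) | u v. True}"
  have im: "(qc_class m a, qc_class m b) \<in> qc_embed m ` C \<longleftrightarrow> codeword m a b \<in> C" for a b
    using inj_on_image_mem_iff[OF inj_on_qc_embed[OF assms(1)] codeword_carrier assms(2), of a b]
    by (simp add: qc_embed_codeword[OF assms(1)])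
  have N: "(qc_class m a, qc_class m b) \<in> N \<longleftrightarrow>
      (\<exists>u v. xm1 m dvd a - u * g11 \<and> xm1 m dvd b - (u * g12 + v * g22))" for a b
    by (simp add: N_def qc_class_eq_iff)
  \<comment> \<open>Both sets contain only pairs of classes, so comparing them on representatives is
    enough.\<close>
  have "\<exists>a b. x = (qc_class m a, qc_class m b)" if "x \<in> qc_embed m ` C \<union> N" for x
    using that by (auto simp: qc_embed_def N_def)
  then have "qc_embed m ` C = N \<longleftrightarrow> (\<forall>a b. (qc_class m a, qc_class m b) \<in> qc_embed m ` C
      \<longleftrightarrow> (qc_class m a, qc_class m b) \<in> N)"
    by (metis UnCI subset_antisym subsetI)
  then show ?thesis
    unfolding generated_by_def span_two_generators N_def[symmetric] im N .
qed

text \<open>Under \<open>(\<ast>)\<close> the rows \<open>(xm1 m, 0)\<close> and \<open>(0, xm1 m)\<close> are already \<open>F[x]\<close>-combinations of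
  the two generators, so congruences modulo \<open>xm1 m\<close> may be replaced by equalities.\<close>

lemma generated_by_star_iff:
  assumes "m \<ge> 1" "C \<subseteq> carrier_vec (2 * m)" "star_conditions m g11 g12 g22"
  shows "generated_by m C g11 g12 g22 \<longleftrightarrow>
    (\<forall>a b. codeword m a b \<in> C \<longleftrightarrow> (\<exists>u v. a = u * g11 \<and> b = u * g12 + v * g22))"
proof -
  obtain h1 h2 s where h: "xm1 m = g11 * h1" "xm1 m = g22 * h2" "h1 * g12 = s * g22"
    by (rule star_conditionsE[OF assms(1,3)])
  have "(\<exists>u v. xm1 m dvd a - u * g11 \<and> xm1 m dvd b - (u * g12 + v * g22))
      \<longleftrightarrow> (\<exists>u v. a = u * g11 \<and> b = u * g12 + v * g22)" for a b
  proof
    assume "\<exists>u v. xm1 m dvd a - u * g11 \<and> xm1 m dvd b - (u * g12 + v * g22)"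
    then obtain u v k l where "a - u * g11 = xm1 m * k" "b - (u * g12 + v * g22) = xm1 m * l"
      by (auto elim!: dvdE)
    then have a: "a = u * g11 + g11 * h1 * k" and b: "b = u * g12 + v * g22 + g22 * h2 * l"
      using h(1,2) by (simp_all add: algebra_simps)
    \<comment> \<open>The first coordinate forces \<open>u + h1 * k\<close> as the coefficient of
      \<open>g1\<close>. The excess \<open>k * (h1 * g12)\<close> in the second coordinate equals
      \<open>k * s * g22\<close> and goes into the coefficient of \<open>g2\<close>.\<close>
    have "b = (u + h1 * k) * g12 - k * (h1 * g12) + v * g22 + g22 * h2 * l"
      unfolding b by (simp add: algebra_simps)
    then have "b = (u + h1 * k) * g12 + (v + h2 * l - k * s) * g22"
      unfolding h(3) by (simp add: algebra_simps)
    moreover have "a = (u + h1 * k) * g11" unfolding a by (simp add: algebra_simps)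
    ultimately show "\<exists>u v. a = u * g11 \<and> b = u * g12 + v * g22" by blast
  next
    assume "\<exists>u v. a = u * g11 \<and> b = u * g12 + v * g22"
    then obtain u v where "a = u * g11" "b = u * g12 + v * g22" by blast
    then have "xm1 m dvd a - u * g11 \<and> xm1 m dvd b - (u * g12 + v * g22)" by simp
    then show "\<exists>u v. xm1 m dvd a - u * g11 \<and> xm1 m dvd b - (u * g12 + v * g22)" by blast
  qed
  then show ?thesis by (simp only: generated_by_iff[OF assms(1,2)])
qed

lemma quasi_cyclic_code_generators_exist:
  fixes C :: "'a :: field vec set"
  assumes m: "m \<ge> 1" and C: "quasi_cyclic_code (2 * m) 2 C"
  obtains g11 g12 g22 where "generated_by m C g11 g12 g22" "star_conditions m g11 g12 g22"
proof -
  \<comment> \<open>The lift of \<open>C\<close> to \<open>F[x]^2\<close>.\<close>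
  define L where "L = {(a, b). codeword m a b \<in> C}"
  have L_add: "(a + c, b + d) \<in> L" if "(a, b) \<in> L" "(c, d) \<in> L" for a b c d
    using that quasi_cyclic_codeD(3)[OF C] by (simp add: L_def codeword_add)
  have L_mult: "(q * a, q * b) \<in> L" if "(a, b) \<in> L" for q a b
    using that codeword_mult_closed[OF m C] by (simp add: L_def)
  have L_minus: "(a - q * c, b - q * d) \<in> L" if "(a, b) \<in> L" "(c, d) \<in> L" for a b c d q
    using L_add[OF that(1) L_mult[OF that(2), of "- q"]] by simp
  have "codeword m (xm1 m) 0 = codeword m 0 (0 :: 'a poly)"
    and "codeword m 0 (xm1 m) = codeword m 0 (0 :: 'a poly)"
    by (simp_all only: codeword_eq_iff[OF m]) simp_all
  then have L_xm1: "(xm1 m, 0) \<in> L" "(0, xm1 m) \<in> L"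
    using quasi_cyclic_codeD(2)[OF C] by (simp_all add: L_def)
  \<comment> \<open>\<open>g11\<close> generates the ideal of first coordinates of the lift;
    \<open>xm1 m\<close> is the nonzero element that starts the degree argument.\<close>
  obtain g11 where g11: "g11 \<in> {a. \<exists>b. (a, b) \<in> L}" "g11 \<noteq> 0"
    and g11_dvd: "\<And>a. a \<in> {a. \<exists>b. (a, b) \<in> L} \<Longrightarrow> g11 dvd a"
  proof (rule poly_ideal_principal[of "xm1 m" "{a. \<exists>b. (a, b) \<in> L}"])
    show "a + c \<in> {a. \<exists>b. (a, b) \<in> L}" if "a \<in> {a. \<exists>b. (a, b) \<in> L}" "c \<in> {a. \<exists>b. (a, b) \<in> L}" for a c
      using that by (auto dest: L_add)
    show "q * a \<in> {a. \<exists>b. (a, b) \<in> L}" if "a \<in> {a. \<exists>b. (a, b) \<in> L}" for a q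
      using that L_mult[of a _ q] by auto
  qed (use L_xm1 xm1_nonzero[OF m] in auto)
  obtain g22 where g22: "g22 \<in> {b. (0, b) \<in> L}" "g22 \<noteq> 0"
    and g22_dvd: "\<And>b. b \<in> {b. (0, b) \<in> L} \<Longrightarrow> g22 dvd b"
  proof (rule poly_ideal_principal[of "xm1 m" "{b. (0, b) \<in> L}"])
    show "b + d \<in> {b. (0, b) \<in> L}" if "b \<in> {b. (0, b) \<in> L}" "d \<in> {b. (0, b) \<in> L}" for b d
      using that L_add[of 0 b 0 d] by simp
    show "q * b \<in> {b. (0, b) \<in> L}" if "b \<in> {b. (0, b) \<in> L}" for b q
      using that L_mult[of 0 b q] by simp
  qed (use L_xm1 xm1_nonzero[OF m] in auto)
  obtain b where b: "(g11, b) \<in> L" using g11 by blast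
  \<comment> \<open>Subtracting a multiple of \<open>(0, g22)\<close> reduces the second coordinate
    modulo \<open>g22\<close>, which secures condition (ii).\<close>
  define g12 where "g12 = b mod g22"
  have g12: "(g11, g12) \<in> L"
    using L_minus[OF b, of 0 g22 "b div g22"] g22(1) by (simp add: g12_def minus_div_mult_eq_mod)
  have L_iff: "(a, b) \<in> L \<longleftrightarrow> (\<exists>u v. a = u * g11 \<and> b = u * g12 + v * g22)" for a b
  proof
    assume ab: "(a, b) \<in> L"
    then have "g11 dvd a" by (intro g11_dvd) blast
    then obtain u where u: "a = g11 * u" by (elim dvdE)
    have "(0, b - u * g12) \<in> L" using L_minus[OF ab g12, of u] u by (simp add: mult.commute)
    then have "g22 dvd b - u * g12" by (intro g22_dvd) simp
    then obtain v where "b - u * g12 = g22 * v" by (elim dvdE)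
    with u have "a = u * g11" "b = u * g12 + v * g22" by (simp_all add: algebra_simps)
    then show "\<exists>u v. a = u * g11 \<and> b = u * g12 + v * g22" by blast
  next
    assume "\<exists>u v. a = u * g11 \<and> b = u * g12 + v * g22"
    then obtain u v where "a = u * g11" "b = u * g12 + v * g22" by blast
    then show "(a, b) \<in> L"
      using L_add[OF L_mult[OF g12, of u] L_mult[of 0 g22 v]] g22(1) by simp
  qed
  have "g11 * g22 dvd xm1 m * g12"
  proof -
    \<comment> \<open>Condition (iii) is read off from expressing \<open>(xm1 m, 0)\<close> in the
      two generators.\<close>
    obtain u v where uv: "xm1 m = u * g11" "0 = u * g12 + v * g22"
      using L_xm1(1) by (auto simp: L_iff)
    have "xm1 m * g12 = g11 * (u * g12)" using uv(1) by simp
    also have "u * g12 = - v * g22" using uv(2) by (simp add: eq_neg_iff_add_eq_0)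
    also have "g11 * (- v * g22) = g11 * g22 * (- v)" by simp
    finally show ?thesis by simp
  qed
  moreover have "ext_degree g12 < ext_degree g22"
    using degree_mod_less[OF g22(2), of b] g22(2) by (auto simp: ext_degree_def g12_def)
  ultimately have star: "star_conditions m g11 g12 g22"
    using g11_dvd[of "xm1 m"] g22_dvd[of "xm1 m"] L_xm1 by (auto simp: star_conditions_def)
  moreover have "generated_by m C g11 g12 g22"
    using L_iff by (simp add: generated_by_star_iff[OF m quasi_cyclic_codeD(1)[OF C] star] L_def)
  ultimately show ?thesis using that by blast
qed

section \<open>Uniqueness of monic generators\<close>

text \<open>The cofactor has degree 0 and leading coefficient 1.\<close>

lemma monic_dvd_antisym:
  fixes p q :: "'a :: idom poly"
  assumes "p dvd q" "q dvd p" "lead_coeff p = 1" "lead_coeff q = 1"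
  shows "p = q"
proof -
  obtain r where r: "q = p * r" using assms(1) by (elim dvdE)
  have nz: "p \<noteq> 0" "q \<noteq> 0" using assms(3,4) by auto
  then have "degree q = degree p"
    using dvd_imp_degree_le[OF assms(1)] dvd_imp_degree_le[OF assms(2)] by simp
  then have "degree r = 0" using r nz by (auto simp: degree_mult_eq)
  moreover have "lead_coeff r = 1" using arg_cong[OF r, of lead_coeff] assms(3,4) by (simp only: lead_coeff_mult mult_1)
  ultimately have "r = 1" by (auto simp: one_pCons elim!: degree_eq_zeroE)
  then show ?thesis using r by simp
qed

text \<open>Both pairs span the same lift, so each generator is a combination of the other pair.
  Comparing coordinates gives mutual divisibility of the diagonal entries, and then
  \<open>g12\<close> and \<open>g12'\<close> are reduced residues of one class modulo
  \<open>g22\<close>.\<close>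

lemma star_generators_unique:
  fixes g11 g12 g22 g11' g12' g22' :: "'a :: field poly"
  assumes m: "m \<ge> 1" and C: "C \<subseteq> carrier_vec (2 * m)"
    and gen: "generated_by m C g11 g12 g22" "generated_by m C g11' g12' g22'"
    and star: "star_conditions m g11 g12 g22" "star_conditions m g11' g12' g22'"
    and monic: "lead_coeff g11 = 1" "lead_coeff g22 = 1" "lead_coeff g11' = 1" "lead_coeff g22' = 1"
  shows "g11 = g11' \<and> g22 = g22' \<and> g12 = g12'"
proof -
  have iff: "(\<exists>u v. a = u * g11 \<and> b = u * g12 + v * g22)
      \<longleftrightarrow> (\<exists>u v. a = u * g11' \<and> b = u * g12' + v * g22')" for a b
    using gen generated_by_star_iff[OF m C star(1)] generated_by_star_iff[OF m C star(2)] by simp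
  have nz: "g11 \<noteq> 0" "g22 \<noteq> 0" "g11' \<noteq> 0" "g22' \<noteq> 0" using monic by auto
  \<comment> \<open>The trivial combination gives \<open>g1\<close> the shape that
    \<open>iff\<close> rewrites.\<close>
  have "\<exists>u v. g11 = u * g11 \<and> g12 = u * g12 + v * g22"
    by (rule exI[of _ 1], rule exI[of _ 0]) simp
  then obtain u v where uv: "g11 = u * g11'" "g12 = u * g12' + v * g22'"
    unfolding iff by blast
  have "\<exists>u v. g11' = u * g11' \<and> g12' = u * g12' + v * g22'"
    by (rule exI[of _ 1], rule exI[of _ 0]) simp
  then obtain u' v' where "g11' = u' * g11" "g12' = u' * g12 + v' * g22"
    unfolding iff[symmetric] by blast
  with uv(1) have "g11 dvd g11'" "g11' dvd g11" by (metis dvd_triv_right)+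
  then have g11: "g11 = g11'" using monic by (intro monic_dvd_antisym)
  have "\<exists>u v. 0 = u * g11 \<and> g22 = u * g12 + v * g22"
    by (rule exI[of _ 0], rule exI[of _ 1]) simp
  then obtain p q where "0 = p * g11'" "g22 = p * g12' + q * g22'"
    unfolding iff by blast
  \<comment> \<open>A zero first coordinate forces \<open>p = 0\<close>, as \<open>g11'\<close> is
    nonzero.\<close>
  then have "g22' dvd g22" using nz by simp
  moreover have "\<exists>u v. 0 = u * g11' \<and> g22' = u * g12' + v * g22'"
    by (rule exI[of _ 0], rule exI[of _ 1]) simp
  then obtain p' q' where "0 = p' * g11" "g22' = p' * g12 + q' * g22"
    unfolding iff[symmetric] by blast
  then have "g22 dvd g22'" using nz by simp
  ultimately have g22: "g22 = g22'" using monic by (intro monic_dvd_antisym)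
  have "u = 1" using uv(1) g11 nz by simp
  then have eq: "g12 - g12' = v * g22" using uv(2) g22 by simp
  have "g12 = 0 \<or> degree g12 < degree g22" by (rule star_conditionsE[OF m star(1)])
  moreover have "g12' = 0 \<or> degree g12' < degree g22'" by (rule star_conditionsE[OF m star(2)])
  ultimately have "g12 mod g22 = g12" "g12' mod g22 = g12'" using g22 by (auto simp: mod_poly_less)
  moreover have "g12 mod g22 = g12' mod g22" using eq by (simp add: mod_eq_dvd_iff)
  ultimately show ?thesis using g11 g22 by simp
qed

lemma generated_by_unique_code:
  assumes "m \<ge> 1" "C \<subseteq> carrier_vec (2 * m)" "C' \<subseteq> carrier_vec (2 * m)"
    and "generated_by m C g11 g12 g22" "generated_by m C' g11 g12 g22"
  shows "C = C'"
  using assms inj_on_image_eq_iff[OF inj_on_qc_embed[OF assms(1)] assms(2,3)]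
  by (simp add: generated_by_def)

section \<open>Dimension of the code\<close>

text \<open>Two adjacent slices of one vector encode a pair of polynomials of bounded degree, so the
  parameter space is a coordinate space of known dimension.\<close>

definition vec_slice_poly :: "nat \<Rightarrow> nat \<Rightarrow> 'a :: field vec \<Rightarrow> 'a poly" where
  "vec_slice_poly n k w = (\<Sum>i<k. monom (w $ (n + i)) i)"

lemma coeff_vec_slice_poly: "coeff (vec_slice_poly n k w) i = (if i < k then w $ (n + i) else 0)"
  by (auto simp: vec_slice_poly_def coeff_sum if_distrib cong: if_cong)

lemma vec_slice_poly_add:
  assumes "v \<in> carrier_vec N" "w \<in> carrier_vec N" "n + k \<le> N"
  shows "vec_slice_poly n k (v + w) = vec_slice_poly n k v + vec_slice_poly n k w"
  using assms by (intro poly_eqI) (auto simp: coeff_vec_slice_poly)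

lemma vec_slice_poly_smult:
  assumes "w \<in> carrier_vec N" "n + k \<le> N"
  shows "vec_slice_poly n k (c \<cdot>\<^sub>v w) = Polynomial.smult c (vec_slice_poly n k w)"
  using assms by (intro poly_eqI) (auto simp: coeff_vec_slice_poly)

lemma vec_slice_poly_mod:
  assumes "h \<noteq> 0"
  shows "vec_slice_poly n (degree h) w mod h = vec_slice_poly n (degree h) w"
\<comment> \<open>A constant \<open>h\<close> gives an empty slice, that is 0, whose degree is not
  below \<open>degree h\<close>.\<close>
proof (cases "vec_slice_poly n (degree h) w = 0")
  case False
  then have "degree (vec_slice_poly n (degree h) w) < degree h"
    by (intro degree_lessI) (auto simp: coeff_vec_slice_poly)
  then show ?thesis by (rule mod_poly_less)
qed simp

lemma vec_slice_poly_eq: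
  assumes "h \<noteq> 0" "\<And>i. i < degree h \<Longrightarrow> w $ (n + i) = coeff (p mod h) i"
  shows "vec_slice_poly n (degree h) w = p mod h"
proof (rule poly_eqI)
  fix i
  show "coeff (vec_slice_poly n (degree h) w) i = coeff (p mod h) i"
  proof (cases "i < degree h")
    case False
    then show ?thesis
      using degree_mod_less[OF assms(1), of p] by (auto simp: coeff_vec_slice_poly coeff_eq_0)
  qed (simp add: coeff_vec_slice_poly assms(2))
qed

text \<open>With \<open>h1\<close> and \<open>h2\<close> the cofactors of \<open>g11\<close> and
  \<open>g22\<close>, the map \<open>T\<close> is a linear isomorphism from the coordinate space of
  dimension \<open>degree h1 + degree h2\<close> onto \<open>C\<close>.\<close>

lemma code_dim_generated_by_star:
  fixes C :: "'a :: field vec set"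
  assumes m: "m \<ge> 1" and C: "quasi_cyclic_code (2 * m) 2 C"
    and gen: "generated_by m C g11 g12 g22" and star: "star_conditions m g11 g12 g22"
  shows "int (code_dim (2 * m) C) = 2 * int m - int (degree g11) - int (degree g22)"
proof -
  obtain h1 h2 s where h: "xm1 m = g11 * h1" "xm1 m = g22 * h2" "h1 * g12 = s * g22"
    and nz: "g11 \<noteq> 0" "g22 \<noteq> 0" "h1 \<noteq> 0" "h2 \<noteq> 0"
    by (rule star_conditionsE[OF m star])
  have iff: "codeword m a b \<in> C \<longleftrightarrow> (\<exists>u v. a = u * g11 \<and> b = u * g12 + v * g22)" for a b
    using gen by (simp add: generated_by_star_iff[OF m quasi_cyclic_codeD(1)[OF C] star])
  let ?k1 = "degree h1" and ?k2 = "degree h2"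
  let ?V = "module_vec TYPE('a) (?k1 + ?k2)"
  let ?W = "module_vec TYPE('a) (2 * m) \<lparr>carrier := C\<rparr>"
  let ?u = "vec_slice_poly 0 ?k1" and ?v = "vec_slice_poly ?k1 ?k2"
  define T where "T w = codeword m (?u w * g11) (?u w * g12 + ?v w * g22)" for w
  have T_add: "T (x + y) = T x + T y" if "x \<in> carrier_vec (?k1 + ?k2)" "y \<in> carrier_vec (?k1 + ?k2)" for x y
    using that by (simp add: T_def codeword_add[symmetric] vec_slice_poly_add[OF that] algebra_simps)
  have T_smult: "T (c \<cdot>\<^sub>v x) = c \<cdot>\<^sub>v T x" if "x \<in> carrier_vec (?k1 + ?k2)" for c x
    by (simp add: T_def codeword_smult[symmetric] vec_slice_poly_smult[OF that] smult_add_right)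
  have T_in: "T w \<in> C" for w by (auto simp: T_def iff)
  have sub: "VectorSpace.subspace class_ring C (module_vec TYPE('a) (2 * m))"
    using C by (simp add: quasi_cyclic_code_def)
  have "linear_map class_ring ?V ?W T"
    unfolding linear_map_def mod_hom_def mod_hom_axioms_def
    using vec_vs vectorspace.subspace_is_vs[OF vec_vs sub] vec_module T_add T_smult T_in
    by (auto simp: module_hom_def module_vec_simps vectorspace_def)
  then interpret T: linear_map class_ring ?V ?W T .
  have inj: "inj_on T (carrier ?V)"
  proof (rule inj_onI)
    fix x y
    assume xy: "x \<in> carrier ?V" "y \<in> carrier ?V" and "T x = T y"
    then have dvd: "xm1 m dvd ?u x * g11 - ?u y * g11"
        "xm1 m dvd ?u x * g12 + ?v x * g22 - (?u y * g12 + ?v y * g22)"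
      by (simp_all add: T_def codeword_eq_iff[OF m])
    \<comment> \<open>Cancelling \<open>g11\<close> leaves a congruence modulo \<open>h1\<close>
      between slices that are already reduced. Once they agree, the \<open>g12\<close> terms drop
      out of the second divisibility, and \<open>g22\<close> cancels in the same way.\<close>
    have "g11 * h1 dvd g11 * (?u x - ?u y)" using dvd(1) h(1) by (simp add: algebra_simps)
    then have "?u x mod h1 = ?u y mod h1" using nz by (simp add: mod_eq_dvd_iff)
    then have u: "?u x = ?u y" by (simp add: vec_slice_poly_mod nz)
    have "g22 * h2 dvd g22 * (?v x - ?v y)" using dvd(2) h(2) u by (simp add: algebra_simps)
    then have "?v x mod h2 = ?v y mod h2" using nz by (simp add: mod_eq_dvd_iff)
    then have v: "?v x = ?v y" by (simp add: vec_slice_poly_mod nz)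
    show "x = y"
    proof (rule eq_vecI)
      fix i assume "i < dim_vec y"
      then have i: "i < ?k1 + ?k2" using xy by (simp add: module_vec_simps)
      show "x $ i = y $ i"
      proof (cases "i < ?k1")
        case True
        then show ?thesis using arg_cong[OF u, of "\<lambda>p. coeff p i"] by (simp add: coeff_vec_slice_poly)
      next
        case False
        then have "i - ?k1 < ?k2" "?k1 + (i - ?k1) = i" using i by simp_all
        then show ?thesis
          using arg_cong[OF v, of "\<lambda>p. coeff p (i - ?k1)"] by (simp only: coeff_vec_slice_poly if_True)
      qed
    qed (use xy in \<open>simp add: module_vec_simps\<close>)
  qed
  have surj: "T ` carrier ?V = carrier ?W"
  proof
    show "T ` carrier ?V \<subseteq> carrier ?W" using T_in by auto
    show "carrier ?W \<subseteq> T ` carrier ?V"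
    proof
      fix c assume "c \<in> carrier ?W"
      then have "c \<in> C" by simp
      moreover from this have "c \<in> carrier_vec (2 * m)" using quasi_cyclic_codeD(1)[OF C] by blast
      ultimately obtain a b where c: "c = codeword m a b" and "codeword m a b \<in> C"
        using codeword_component_poly[OF m] by metis
      then obtain p q where ab: "a = p * g11" "b = p * g12 + q * g22" using iff by blast
      \<comment> \<open>Replacing \<open>p\<close> by its remainder modulo \<open>h1\<close> removes
        \<open>t h1 g1\<close>, which is \<open>(t * xm1 m, t * s * g22)\<close>. The first entry
        vanishes modulo \<open>xm1 m\<close>; the second is compensated by adding
        \<open>t * s\<close> to \<open>q\<close>, and the result \<open>r\<close> may be reduced
        modulo \<open>h2\<close>.\<close>
      define t where "t = p div h1"
      define r where "r = q + t * s"
      define w where "w = vec (?k1 + ?k2)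
        (\<lambda>i. if i < ?k1 then coeff (p mod h1) i else coeff (r mod h2) (i - ?k1))"
      have u: "?u w = p mod h1" and v: "?v w = r mod h2"
        by (rule vec_slice_poly_eq, use nz in \<open>simp_all add: w_def\<close>)+
      have p: "p - p mod h1 = t * h1" by (simp add: t_def minus_mod_eq_div_mult)
      have "a - (p mod h1) * g11 = xm1 m * t"
        using arg_cong[OF p, of "\<lambda>x. x * g11"] by (simp add: ab h(1) algebra_simps)
      moreover have "b - ((p mod h1) * g12 + (r mod h2) * g22) = xm1 m * (r div h2)"
      proof -
        have "(p - p mod h1) * g12 = t * s * g22" unfolding p using h(3) by (simp add: mult.assoc)
        then have "b - ((p mod h1) * g12 + (r mod h2) * g22) = (r - r mod h2) * g22"
          by (simp add: ab r_def algebra_simps)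
        also have "\<dots> = xm1 m * (r div h2)"
          by (simp add: minus_mod_eq_div_mult h(2))
        finally show ?thesis .
      qed
      ultimately have "c = T w"
        unfolding c T_def u v by (simp add: codeword_eq_iff[OF m])
      then show "c \<in> T ` carrier ?V" by (simp add: w_def module_vec_simps)
    qed
  qed
  have "vectorspace.dim class_ring ?V = vectorspace.dim class_ring ?W"
    using T.dim_eq[OF vec_space.fin_dim inj surj] .
  then have "code_dim (2 * m) C = ?k1 + ?k2"
    unfolding code_dim_def using vec_space.dim_is_n by metis
  moreover have "degree g11 + ?k1 = m" "degree g22 + ?k2 = m"
    using degree_xm1[OF m, where 'a = 'a] h(1,2) nz by (metis degree_mult_eq)+
  ultimately show ?thesis by linarith
qed

theorem theorem3p1:
  fixes m :: nat
  assumes "m \<ge> 1"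
  shows
    "(\<forall>C :: 'a :: {field, finite} vec set. quasi_cyclic_code (2 * m) 2 C \<longrightarrow>
        (\<exists>g11 g12 g22. generated_by m C g11 g12 g22 \<and> star_conditions m g11 g12 g22) \<and>
        (\<forall>g11 g12 g22. generated_by m C g11 g12 g22 \<and> star_conditions m g11 g12 g22 \<longrightarrow>
          int (code_dim (2 * m) C) = 2 * int m - int (degree g11) - int (degree g22)))
     \<and>
     (\<forall>(C :: 'a vec set) (C' :: 'a vec set) g11 g12 g22 g11' g12' g22'.
        quasi_cyclic_code (2 * m) 2 C \<and> quasi_cyclic_code (2 * m) 2 C' \<and>
        generated_by m C g11 g12 g22 \<and> star_conditions m g11 g12 g22 \<and>
        generated_by m C' g11' g12' g22' \<and> star_conditions m g11' g12' g22' \<and>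
        lead_coeff g11 = 1 \<and> lead_coeff g22 = 1 \<and>
        lead_coeff g11' = 1 \<and> lead_coeff g22' = 1 \<longrightarrow>
        (C = C' \<longleftrightarrow> g11 = g11' \<and> g22 = g22' \<and> g12 = g12'))"
proof (intro conjI allI impI, goal_cases)
  case (1 C)
  then show ?case using quasi_cyclic_code_generators_exist[OF assms] by metis
next
  case (2 C g11 g12 g22)
  then show ?case using code_dim_generated_by_star[OF assms] by blast
next
  case (3 C C' g11 g12 g22 g11' g12' g22')
  then have sub: "C \<subseteq> carrier_vec (2 * m)" "C' \<subseteq> carrier_vec (2 * m)"
    using quasi_cyclic_codeD(1) by blast+
  show ?case
  proof
    assume "C = C'"
    with 3 show "g11 = g11' \<and> g22 = g22' \<and> g12 = g12'"
      by (intro star_generators_unique[OF assms sub(1)]) auto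
  next
    assume "g11 = g11' \<and> g22 = g22' \<and> g12 = g12'"
    with 3 show "C = C'"
      by (intro generated_by_unique_code[OF assms sub, of g11 g12 g22]) auto
  qed
qed

end
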